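(* Let $\pi^*_\alpha$ be the Nash equilibrium of the regularized preference model $\mathcal P_\alpha$, and let $(\pi_t)_{t\ge1}$, with mixture policies $(\pi_t^\alpha)_{t\ge1}$, be produced by MTPO-$\tau$ with learning rates $\eta_t=\frac{2}{\alpha(t+2)}$. Let $\mathbb Q$ be a bound on the magnitude of the Q-functions, i.e. $|Q_\alpha^{\pi_t^\alpha,\pi_t^\alpha}(x,y)|\le\mathbb Q$ for all $t\ge1$, all non-terminal states $x$ and all $y\in\mathcal Y$. Then for every iteration $t\ge1$, $$\mathrm{KL}_p(\pi^*_\alpha\,\|\,\pi_t^\alpha)\le\frac{9\,H\,\mathbb Q^2}{\alpha^2(t+1)}.$$
   Context: MDP. Fix a finite-horizon MDP with horizon $H\ge1$, finite state space $\mathcal X=\bigsqcup_{h=1}^{H+1}\mathcal X_h$ (disjoint union), finite action space $\mathcal Y$, initial state $x_1\in\mathcal X_1$, and transition function $p$, where for $x_h\in\mathcal X_h$ ($h\le H$) and $y_h\in\mathcal Y$, $p(\cdot\mid x_h,y_h)$ is a probability distribution on $\mathcal X_{h+1}$. A policy $\pi$ assigns to each non-terminal state $x$ (i.e. $x\in\mathcal X_h$, $h\le H$) a probability distribution $\pi(\cdot\mid x)$ on $\mathcal Y$. $\Pr_{\pi,p},\mathbb E_{\pi,p}$ refer to the random trajectory $(x_1,y_1,\dots,x_H,y_H,x_{H+1})$ with $y_h\sim\pi(\cdot\mid x_h)$, $x_{h+1}\sim p(\cdot\mid x_h,y_h)$; conditioning on $x_h,y_h$ means the trajectory is started at $x_h$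 with action $y_h$ and continued with $\pi,p$. KL. $\mathrm{KL}(\pi\|\pi')[x]=\sum_{y}\pi(y\mid x)\log\frac{\pi(y\mid x)}{\pi'(y\mid x)}$. $\mathrm{KL}_p(\pi\|\pi')$ is the KL divergence between the distributions over trajectories induced by $\pi$ and by $\pi'$ (with the same $p$). Preferences. $\mathcal P(x\succ x')\in[0,1]$ is given for $x,x'\in\mathcal X_{H+1}$, with $\mathcal P(x'\succ x)=1-\mathcal P(x\succ x')$. For policies, $\mathcal P(x\succ\pi')=\mathbb E_{\pi',p}[\mathcal P(x\succ x_{H+1})]$ and $\mathcal P(\pi\succ\pi')=\mathbb E_{\pi,p}[\mathcal P(x_{H+1}\succ\pi')]$. Fix a reference policy $\mu$ and $\alpha>0$. All policies considered satisfy $\pi(y\mid x)=0$ whenever $\mu(y\mid x)=0$. The regularized preference model is $\mathcal P_\alpha(\pi\succ\pi')=\mathcal P(\pi\succ\pi')-\alpha\,\mathrm{KL}_p(\pi\|\mu)+\alpha\,\mathrm{KL}_p(\pi'\|\mu)$. A policy $\pi^*$ is a Nash equilibrium of $\mathcal P_\alpha$ if $\mathcal P_\alpha(\pi\succ\pi^* )\le\mathcal P_\alpha(\pi^*\succ\pi^* )\le\mathcal P_\alpha(\pi^*\succ\pi)$ for all policies $\pi$; it is unique up to its values at states not reachable under $\mu$. Q-function. $Q_\alpha^{\pi,\pi'}(x_h,y_h)=\mathbb E_{\pi,p}\big[\mathcal P(x_{H+1}\succ\pi')-\alpha\sum_{h'=h}^H\mathrm{KL}(\pi\|\mu)[x_{h'}]\,\big|\,x_h,y_h\big]$.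 MTPO-$\tau$. $\pi_1=\mu$. For $t\ge1$ the mixture policy is $$\pi_t^\alpha(y\mid x)=\frac{\pi_t(y\mid x)^{1-\eta_t\alpha}\mu(y\mid x)^{\eta_t\alpha}}{\sum_{y'}\pi_t(y'\mid x)^{1-\eta_t\alpha}\mu(y'\mid x)^{\eta_t\alpha}},$$ and for every non-terminal state $x$, $\pi_{t+1}(\cdot\mid x)=\arg\max_{\pi(\cdot\mid x)}\ \eta_t\sum_y\pi(y\mid x)Q_\alpha^{\pi_t^\alpha,\pi_t^\alpha}(x,y)-\mathrm{KL}(\pi\|\pi_t^\alpha)[x]$, equivalently $\pi_{t+1}(y\mid x)\propto\pi_t^\alpha(y\mid x)e^{\eta_tQ_\alpha^{\pi_t^\alpha,\pi_t^\alpha}(x,y)}$. *)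

theory Defs
  imports "HOL-Probability.Probability"
begin

record ('x, 'y) pref_mdp =
  horizon :: nat
  layer :: "nat \<Rightarrow> 'x set"
  start :: 'x
  kernel :: "'x \<Rightarrow> 'y \<Rightarrow> 'x pmf"
  pref :: "'x \<Rightarrow> 'x \<Rightarrow> real"

text \<open>
  The action space is the type \<^typ>\<open>'y::finite\<close>. The state space is the disjoint union of the
  layers \<open>1, \<dots>, H + 1\<close>; the values of all fields outside these layers are irrelevant.
\<close>

definition pref_mdp_wf :: "('x, 'y::finite) pref_mdp \<Rightarrow> bool" where
  "pref_mdp_wf M \<longleftrightarrow>
     1 \<le> horizon M \<and>
     (\<forall>h\<in>{1..horizon M + 1}. finite (layer M h)) \<and>
     disjoint_family_on (layer M) {1..horizon M + 1} \<and>
     start M \<in> layer M 1 \<and>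
     (\<forall>h\<in>{1..horizon M}. \<forall>x\<in>layer M h. \<forall>y. set_pmf (kernel M x y) \<subseteq> layer M (h + 1)) \<and>
     (\<forall>x\<in>layer M (horizon M + 1). \<forall>x'\<in>layer M (horizon M + 1).
        0 \<le> pref M x x' \<and> pref M x x' \<le> 1 \<and> pref M x' x = 1 - pref M x x')"

definition decision_states :: "('x, 'y::finite) pref_mdp \<Rightarrow> 'x set" where
  "decision_states M = (\<Union>h\<in>{1..horizon M}. layer M h)"

type_synonym ('x, 'y) policy = "'x \<Rightarrow> 'y pmf"

text \<open>
  A policy is only meaningful on \<^const>\<open>decision_states\<close> states; its other values are never used.
\<close>

definition admissible :: "('x, 'y::finite) pref_mdp \<Rightarrow> ('x, 'y) policy \<Rightarrow> ('x, 'y) policy \<Rightarrow> bool" where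
  "admissible M \<mu> \<pi> \<longleftrightarrow>
     (\<forall>x\<in>decision_states M. \<forall>y. pmf (\<mu> x) y = 0 \<longrightarrow> pmf (\<pi> x) y = 0)"

text \<open>
  A trajectory is the list of its state-action pairs together with its last state.
  \<open>traj_from M \<pi> n x\<close> plays \<open>n\<close> steps starting in \<open>x\<close>; \<open>traj_from_action M \<pi> n x y\<close>
  does the same for \<open>n + 1\<close> steps whose first action is forced to be \<open>y\<close>.
\<close>

type_synonym ('x, 'y) trajectory = "('x \<times> 'y) list \<times> 'x"

primrec traj_from ::
  "('x, 'y::finite) pref_mdp \<Rightarrow> ('x, 'y) policy \<Rightarrow> nat \<Rightarrow> 'x \<Rightarrow> ('x, 'y) trajectory pmf" where
  "traj_from M \<pi> 0 x = return_pmf ([], x)"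
| "traj_from M \<pi> (Suc n) x =
     bind_pmf (\<pi> x) (\<lambda>y. bind_pmf (kernel M x y) (\<lambda>x'.
       map_pmf (\<lambda>(xys, z). ((x, y) # xys, z)) (traj_from M \<pi> n x')))"

definition traj_from_action ::
  "('x, 'y::finite) pref_mdp \<Rightarrow> ('x, 'y) policy \<Rightarrow> nat \<Rightarrow> 'x \<Rightarrow> 'y \<Rightarrow> ('x, 'y) trajectory pmf" where
  "traj_from_action M \<pi> n x y =
     bind_pmf (kernel M x y) (\<lambda>x'.
       map_pmf (\<lambda>(xys, z). ((x, y) # xys, z)) (traj_from M \<pi> n x'))"

definition traj :: "('x, 'y::finite) pref_mdp \<Rightarrow> ('x, 'y) policy \<Rightarrow> ('x, 'y) trajectory pmf" where
  "traj M \<pi> = traj_from M \<pi> (horizon M) (start M)"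

definition KL_act :: "'y::finite pmf \<Rightarrow> 'y pmf \<Rightarrow> real" where
  "KL_act d d' = (\<Sum>y\<in>UNIV. pmf d y * ln (pmf d y / pmf d' y))"

text \<open>
  \<^const>\<open>KL_divergence\<close> takes the reference measure first, and the base of the logarithm as a parameter.
\<close>

definition KL_traj ::
  "('x, 'y::finite) pref_mdp \<Rightarrow> ('x, 'y) policy \<Rightarrow> ('x, 'y) policy \<Rightarrow> real" where
  "KL_traj M \<pi> \<pi>' =
     KL_divergence (exp 1) (measure_pmf (traj M \<pi>')) (measure_pmf (traj M \<pi>))"

lemma KL_divergence_pmf_finite:
  assumes fin: "finite (set_pmf p)" and sub: "set_pmf p \<subseteq> set_pmf q"
  shows "KL_divergence (exp 1) (measure_pmf q) (measure_pmf p) =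
    (\<Sum>x\<in>set_pmf p. pmf p x * ln (pmf p x / pmf q x))"
proof -
  let ?f = "\<lambda>x. pmf p x / pmf q x"
  have eq: "ennreal (pmf q x) * ennreal (?f x) = ennreal (pmf p x)" for x
    using sub by (cases "pmf q x = 0") (auto simp: set_pmf_iff simp flip: ennreal_mult)
  have "measure_pmf p = density (measure_pmf q) ?f"
    by (subst (1 2) measure_pmf_eq_density) (simp add: density_density_eq eq)
  then have "KL_divergence (exp 1) (measure_pmf q) (measure_pmf p) =
      (\<integral>x. ?f x * log (exp 1) (?f x) \<partial>measure_pmf q)"
    by (simp add: sigma_finite_measure.KL_density[OF prob_space_imp_sigma_finite[OF prob_space_measure_pmf]])
  also have "\<dots> = (\<Sum>x\<in>set_pmf p. ?f x * log (exp 1) (?f x) * pmf q x)"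
    using fin by (intro integral_measure_pmf_real) (auto simp: set_pmf_iff)
  also have "\<dots> = (\<Sum>x\<in>set_pmf p. pmf p x * ln (pmf p x / pmf q x))"
    using sub by (intro sum.cong refl) (auto simp: set_pmf_iff log_def)
  finally show ?thesis .
qed

definition pref_state ::
  "('x, 'y::finite) pref_mdp \<Rightarrow> 'x \<Rightarrow> ('x, 'y) policy \<Rightarrow> real" where
  "pref_state M x \<pi>' = measure_pmf.expectation (traj M \<pi>') (\<lambda>(xys, z). pref M x z)"

definition pref_policy ::
  "('x, 'y::finite) pref_mdp \<Rightarrow> ('x, 'y) policy \<Rightarrow> ('x, 'y) policy \<Rightarrow> real" where
  "pref_policy M \<pi> \<pi>' = measure_pmf.expectation (traj M \<pi>) (\<lambda>(xys, z). pref_state M z \<pi>')"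

definition reg_pref ::
  "('x, 'y::finite) pref_mdp \<Rightarrow> ('x, 'y) policy \<Rightarrow> real \<Rightarrow> ('x, 'y) policy \<Rightarrow> ('x, 'y) policy \<Rightarrow> real" where
  "reg_pref M \<mu> \<alpha> \<pi> \<pi>' = pref_policy M \<pi> \<pi>' - \<alpha> * KL_traj M \<pi> \<mu> + \<alpha> * KL_traj M \<pi>' \<mu>"

definition nash_equilibrium ::
  "('x, 'y::finite) pref_mdp \<Rightarrow> ('x, 'y) policy \<Rightarrow> real \<Rightarrow> ('x, 'y) policy \<Rightarrow> bool" where
  "nash_equilibrium M \<mu> \<alpha> \<pi>s \<longleftrightarrow>
     admissible M \<mu> \<pi>s \<and>
     (\<forall>\<pi>. admissible M \<mu> \<pi> \<longrightarrow>
        reg_pref M \<mu> \<alpha> \<pi> \<pi>s \<le> reg_pref M \<mu> \<alpha> \<pi>s \<pi>s \<and>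
        reg_pref M \<mu> \<alpha> \<pi>s \<pi>s \<le> reg_pref M \<mu> \<alpha> \<pi>s \<pi>)"

text \<open>
  The layer \<open>h\<close> of the state \<open>x\<close> is an explicit argument. The sum over the state-action pairs of the
  trajectory is the sum over the steps \<open>h, \<dots>, H\<close>, so it includes the term of \<open>x\<close> itself.
\<close>

definition Qfun ::
  "('x, 'y::finite) pref_mdp \<Rightarrow> ('x, 'y) policy \<Rightarrow> real \<Rightarrow> ('x, 'y) policy \<Rightarrow> ('x, 'y) policy \<Rightarrow>
    nat \<Rightarrow> 'x \<Rightarrow> 'y \<Rightarrow> real" where
  "Qfun M \<mu> \<alpha> \<pi> \<pi>' h x y =
     measure_pmf.expectation (traj_from_action M \<pi> (horizon M - h) x y)
       (\<lambda>(xys, z). pref_state M z \<pi>' - \<alpha> * (\<Sum>(x', y')\<leftarrow>xys. KL_act (\<pi> x') (\<mu> x')))"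

text \<open>
  Geometric mixture with weight \<open>c\<close> on \<open>d'\<close>. Since \<open>0 powr a = 0\<close>, this is intended for \<open>0 < c < 1\<close>;
  the density is a genuine one whenever the supports of \<open>d\<close> and \<open>d'\<close> meet, see \<open>pmf_geo_mixture\<close>.
\<close>

definition geo_mixture :: "real \<Rightarrow> 'y::finite pmf \<Rightarrow> 'y pmf \<Rightarrow> 'y pmf" where
  "geo_mixture c d d' = embed_pmf (\<lambda>y.
     pmf d y powr (1 - c) * pmf d' y powr c /
       (\<Sum>y'\<in>UNIV. pmf d y' powr (1 - c) * pmf d' y' powr c))"

lemma pmf_geo_mixture:
  assumes "set_pmf d \<inter> set_pmf d' \<noteq> {}"
  shows "pmf (geo_mixture c d d') y =
    pmf d y powr (1 - c) * pmf d' y powr c /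
      (\<Sum>y'\<in>UNIV. pmf d y' powr (1 - c) * pmf d' y' powr c)"
proof -
  let ?w = "\<lambda>y. pmf d y powr (1 - c) * pmf d' y powr c"
  obtain y0 where "pmf d y0 \<noteq> 0" "pmf d' y0 \<noteq> 0"
    using assms by (auto simp: set_pmf_iff)
  then have "?w y0 > 0"
    by simp
  moreover have "?w y0 \<le> sum ?w UNIV"
    by (rule member_le_sum) auto
  ultimately have pos: "sum ?w UNIV > 0"
    by linarith
  show ?thesis
    unfolding geo_mixture_def
  proof (rule pmf_embed_pmf)
    show "0 \<le> ?w y / sum ?w UNIV" for y
      using pos by simp
    have "(\<integral>\<^sup>+ y. ennreal (?w y / sum ?w UNIV) \<partial>count_space UNIV) =
        (\<Sum>y\<in>UNIV. ennreal (?w y / sum ?w UNIV))"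
      by (simp add: nn_integral_count_space_finite)
    also have "\<dots> = ennreal (\<Sum>y\<in>UNIV. ?w y / sum ?w UNIV)"
      using pos by (intro sum_ennreal) simp
    also have "(\<Sum>y\<in>UNIV. ?w y / sum ?w UNIV) = 1"
      using pos by (simp flip: sum_divide_distrib)
    finally show "(\<integral>\<^sup>+ y. ennreal (?w y / sum ?w UNIV) \<partial>count_space UNIV) = 1"
      by simp
  qed
qed

definition mixture_policy ::
  "('x, 'y::finite) policy \<Rightarrow> real \<Rightarrow> (nat \<Rightarrow> real) \<Rightarrow> (nat \<Rightarrow> ('x, 'y) policy) \<Rightarrow> nat \<Rightarrow> ('x, 'y) policy" where
  "mixture_policy \<mu> \<alpha> \<eta> \<pi> t = (\<lambda>x. geo_mixture (\<eta> t * \<alpha>) (\<pi> t x) (\<mu> x))"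

text \<open>The iterates are indexed from \<open>1\<close>; the value at \<open>0\<close> is irrelevant.\<close>

definition mtpo_tau ::
  "('x, 'y::finite) pref_mdp \<Rightarrow> ('x, 'y) policy \<Rightarrow> real \<Rightarrow> (nat \<Rightarrow> real) \<Rightarrow>
    (nat \<Rightarrow> ('x, 'y) policy) \<Rightarrow> bool" where
  "mtpo_tau M \<mu> \<alpha> \<eta> \<pi> \<longleftrightarrow>
     (\<forall>x\<in>decision_states M. \<pi> 1 x = \<mu> x) \<and>
     (\<forall>t\<ge>1. \<forall>h\<in>{1..horizon M}. \<forall>x\<in>layer M h.
        let \<pi>\<alpha> = mixture_policy \<mu> \<alpha> \<eta> \<pi> t in
        is_arg_max
          (\<lambda>d. \<eta> t * (\<Sum>y\<in>UNIV. pmf d y * Qfun M \<mu> \<alpha> \<pi>\<alpha> \<pi>\<alpha> h x y) - KL_act d (\<pi>\<alpha> x))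
          (\<lambda>d. \<forall>y. pmf (\<mu> x) y = 0 \<longrightarrow> pmf d y = 0)
          (\<pi> (t + 1) x))"

end

theory Submission
  imports Defs
begin

text \<open>
  Write \<open>c = \<eta>\<^sub>t \<alpha> = 2 / (t + 2)\<close>, \<open>G = H Q\<^sup>2 / \<alpha>\<^sup>2\<close> and \<open>A\<^sub>t = KL\<^sub>p(\<pi>\<^sup>* | \<pi>\<^sub>t)\<close>. The mirror step is
  an exponential tilt of the mixture policy \<open>m\<close>, so Hoeffding's lemma bounds its effect on
  \<open>KL(\<pi>\<^sup>* | \<cdot>)[x]\<close> by \<open>- \<eta>\<^sub>t \<langle>\<pi>\<^sup>* - m, Q\<rangle>[x] + \<eta>\<^sub>t\<^sup>2 Q\<^sup>2 / 2\<close>. Summed along trajectories of \<open>\<pi>\<^sup>*\<close>, the inner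
  products give the regularised gap between \<open>\<pi>\<^sup>*\<close> and \<open>m\<close> (performance difference), which is
  nonnegative because \<open>\<pi>\<^sup>*\<close> is an equilibrium, up to \<open>\<alpha>\<close> times KL terms relative to \<open>\<mu>\<close>; the geometric
  mixture absorbs these terms and leaves \<open>A\<^sub>t\<^sub>+\<^sub>1 \<le> (1 - c) A\<^sub>t + H \<eta>\<^sub>t\<^sup>2 Q\<^sup>2 / 2\<close>. A fictitious step of size
  \<open>2 / \<alpha>\<close> from \<open>\<mu>\<close> yields \<open>A\<^sub>1 \<le> 2 G\<close>. Hence \<open>A\<^sub>t \<le> 2 G / t\<close>, and the mixture policy satisfies
  \<open>KL\<^sub>p(\<pi>\<^sup>* | m) \<le> (1 - c) A\<^sub>t + c A\<^sub>1 \<le> 6 G / (t + 2)\<close>.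
\<close>

subsection \<open>Distributions on actions\<close>

text \<open>Subtracting \<open>pmf p y - pmf q y\<close>, which sums to zero, makes every summand
  nonnegative: with \<open>r = q / p\<close> it becomes \<open>p * (r - 1 - ln r)\<close>, which
  vanishes only at \<open>r = 1\<close>. Where \<open>p\<close> vanishes the summand is just
  \<open>pmf q y\<close>.\<close>

lemma KL_act_nonneg:
  assumes "set_pmf p \<subseteq> set_pmf q"
  shows "0 \<le> KL_act p q"
    and "KL_act p q = 0 \<Longrightarrow> p = q"
proof -
  define e where "e = (\<lambda>y. pmf p y * ln (pmf p y / pmf q y) - (pmf p y - pmf q y))"
  have e: "0 \<le> e y \<and> (e y = 0 \<longrightarrow> pmf p y = pmf q y)" for y
  proof (cases "pmf p y = 0")
    case False
    then have pos: "0 < pmf p y" "0 < pmf q y"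
      using assms by (auto simp: set_pmf_iff pmf_pos)
    define r where "r = pmf q y / pmf p y"
    have r: "0 < r" "pmf q y = r * pmf p y"
      using pos by (auto simp: r_def)
    have "ln (pmf p y / pmf q y) = - ln r"
      using pos by (simp add: r_def ln_div)
    then have "e y = pmf p y * (r - 1 - ln r)"
      by (simp add: e_def r(2) algebra_simps)
    moreover have "ln r \<le> r - 1"
      using r(1) by (rule ln_le_minus_one)
    moreover have "r = 1" if "ln r = r - 1"
      using that r(1) ln_eq_minus_one by blast
    ultimately show ?thesis
      using pos r(2) by fastforce
  qed (simp add: e_def)
  have sum_e: "sum e UNIV = KL_act p q"
    by (simp add: e_def KL_act_def sum_subtractf sum_pmf_eq_1)
  show "0 \<le> KL_act p q"
    using e by (simp flip: sum_e add: sum_nonneg)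
  assume "KL_act p q = 0"
  then have "e y = 0" for y
    using e sum_e by (simp add: sum_nonneg_eq_0_iff)
  then show "p = q"
    using e by (intro pmf_eqI) blast
qed

lemma KL_act_self [simp]: "KL_act p p = 0"
  unfolding KL_act_def by (rule sum.neutral) (auto simp: divide_self_if)

lemma sum_pmf_add_const:
  fixes p :: "'y::finite pmf"
  shows "(\<Sum>y\<in>UNIV. pmf p y * (a + f y)) = a + (\<Sum>y\<in>UNIV. pmf p y * f y)"
  by (simp add: algebra_simps sum.distrib sum_pmf_eq_1 flip: sum_distrib_left)

text \<open>
  The logarithm of the normalisation constant is eliminated by evaluating the first identity of the
  proof once more at \<open>p = geo_mixture c d m\<close>.
\<close>

lemma geo_mixture_KL:
  fixes d m :: "'y::finite pmf"
  assumes c: "0 < c" "c < 1" and dm: "set_pmf d = set_pmf m"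
  shows "set_pmf (geo_mixture c d m) = set_pmf m"
    and "set_pmf p \<subseteq> set_pmf m \<Longrightarrow>
      KL_act p (geo_mixture c d m) + c * KL_act (geo_mixture c d m) m
        \<le> (1 - c) * KL_act p d + c * KL_act p m"
proof -
  define w where "w = (\<lambda>y. pmf d y powr (1 - c) * pmf m y powr c)"
  define Z where "Z = sum w UNIV"
  let ?g = "geo_mixture c d m"
  have "set_pmf d \<inter> set_pmf m \<noteq> {}"
    using dm set_pmf_not_empty by auto
  from pmf_geo_mixture[OF this] have g: "pmf ?g y = w y / Z" for y
    by (simp add: w_def Z_def)
  have w: "w y = 0 \<longleftrightarrow> pmf m y = 0" "0 \<le> w y" for y
    using dm by (auto simp: w_def set_pmf_eq)
  \<comment> \<open>If \<open>Z\<close> were 0, division by zero would make every mass 0, although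
    the masses sum to 1.\<close>
  have "Z \<noteq> 0"
    using sum_pmf_eq_1[of UNIV ?g] by (auto simp: g)
  then have Z: "0 < Z"
    using w(2) by (simp add: Z_def order_less_le sum_nonneg)
  show sg: "set_pmf ?g = set_pmf m"
    using w(1) Z by (auto simp: set_pmf_iff g)
  have id: "KL_act p ?g = (1 - c) * KL_act p d + c * KL_act p m + ln Z"
    if p: "set_pmf p \<subseteq> set_pmf m" for p
  proof -
    have "pmf p y * ln (pmf p y / pmf ?g y) =
        pmf p y * (ln Z + ((1 - c) * ln (pmf p y / pmf d y) + c * ln (pmf p y / pmf m y)))" for y
    proof (cases "pmf p y = 0")
      case False
      then have "y \<in> set_pmf p" "y \<in> set_pmf m" "y \<in> set_pmf d"
        using p dm by (auto simp: set_pmf_iff)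
      then have pos: "0 < pmf p y" "0 < pmf m y" "0 < pmf d y"
        by (auto intro: pmf_positive)
      then have "ln (pmf ?g y) = (1 - c) * ln (pmf d y) + c * ln (pmf m y) - ln Z"
        using Z by (simp add: g w_def ln_div ln_mult ln_powr)
      moreover have "0 < pmf ?g y"
        using \<open>y \<in> set_pmf m\<close> sg by (simp add: pmf_positive)
      ultimately have "ln (pmf p y / pmf ?g y) =
          ln Z + ((1 - c) * ln (pmf p y / pmf d y) + c * ln (pmf p y / pmf m y))"
        using pos by (simp add: ln_div algebra_simps)
      then show ?thesis
        by simp
    qed simp
    then show ?thesis
      unfolding KL_act_def
      by (simp only: sum_pmf_add_const) (simp add: algebra_simps sum.distrib sum_distrib_left sum_subtractf)
  qed
  assume p: "set_pmf p \<subseteq> set_pmf m"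
  have "0 = (1 - c) * KL_act ?g d + c * KL_act ?g m + ln Z"
    using id[of ?g] sg by simp
  \<comment> \<open>Dropping this term turns the identity into an inequality. The term
    \<open>c * KL_act ?g m\<close> is kept because it later pays for the regulariser of the mixture
    policy.\<close>
  moreover have "0 \<le> (1 - c) * KL_act ?g d"
    using c sg dm by (simp add: KL_act_nonneg(1))
  ultimately show "KL_act p ?g + c * KL_act ?g m \<le> (1 - c) * KL_act p d + c * KL_act p m"
    using id[OF p] by linarith
qed

text \<open>The witness is the Gibbs distribution proportional to \<open>q * exp f\<close>. The KL
  identity serves twice: it identifies the maximiser of the mirror step and measures progress
  towards any comparator \<open>p\<close>.\<close>

lemma exists_exp_tilt:
  fixes q :: "'y::finite pmf" and f :: "'y \<Rightarrow> real"
  obtains g where "set_pmf g = set_pmf q"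
    and "\<And>p. set_pmf p \<subseteq> set_pmf q \<Longrightarrow>
      KL_act p g = KL_act p q - (\<Sum>y\<in>UNIV. pmf p y * f y) + ln (\<Sum>y\<in>UNIV. pmf q y * exp (f y))"
proof -
  define w where "w = (\<lambda>y. pmf q y * exp (f y))"
  define Z where "Z = sum w UNIV"
  obtain y0 where "y0 \<in> set_pmf q"
    using set_pmf_not_empty[of q] by auto
  then have "0 < w y0"
    by (simp add: w_def pmf_pos set_pmf_iff)
  also have "w y0 \<le> Z"
    unfolding Z_def by (rule member_le_sum) (auto simp: w_def)
  finally have Z: "0 < Z" .
  define g where "g = embed_pmf (\<lambda>y. w y / Z)"
  have "(\<Sum>y\<in>UNIV. ennreal (w y / Z)) = ennreal (\<Sum>y\<in>UNIV. w y / Z)"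
    using Z by (intro sum_ennreal) (simp add: w_def)
  also have "(\<Sum>y\<in>UNIV. w y / Z) = 1"
    using Z by (simp add: Z_def flip: sum_divide_distrib)
  finally have g: "pmf g y = w y / Z" for y
    unfolding g_def using Z
    by (intro pmf_embed_pmf) (auto simp: w_def nn_integral_count_space_finite)
  show thesis
  proof (rule that[of g])
    show sg: "set_pmf g = set_pmf q"
      using Z by (auto simp: set_pmf_iff g w_def)
    fix p :: "'y pmf"
    assume p: "set_pmf p \<subseteq> set_pmf q"
    have "pmf p y * ln (pmf p y / pmf g y) =
        pmf p y * (ln Z + (ln (pmf p y / pmf q y) - f y))" for y
    proof (cases "pmf p y = 0")
      case False
      then have pos: "0 < pmf p y" "0 < pmf q y"
        using p by (auto simp: set_pmf_eq pmf_pos)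
      then show ?thesis
        using Z by (simp add: g w_def ln_div ln_mult)
    qed simp
    then show "KL_act p g = KL_act p q - (\<Sum>y\<in>UNIV. pmf p y * f y)
        + ln (\<Sum>y\<in>UNIV. pmf q y * exp (f y))"
      unfolding KL_act_def w_def[symmetric] Z_def[symmetric]
      by (simp only: sum_pmf_add_const) (simp add: algebra_simps sum_subtractf)
  qed
qed

text \<open>Hoeffding's lemma for \<open>f\<close> under \<open>q\<close>: the range has length
  \<open>2 * B\<close>, and \<open>s^2 * (2 * B)^2 / 8 = s^2 * B^2 / 2\<close>.\<close>

lemma ln_sum_exp_le:
  fixes q :: "'y::finite pmf" and f :: "'y \<Rightarrow> real"
  assumes s: "0 < s" and B: "\<And>y. \<bar>f y\<bar> \<le> B"
  shows "ln (\<Sum>y\<in>UNIV. pmf q y * exp (s * f y)) \<le> s * (\<Sum>y\<in>UNIV. pmf q y * f y) + s\<^sup>2 * B\<^sup>2 / 2"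
proof -
  interpret prob_space "measure_pmf q" by (rule prob_space_measure_pmf)
  interpret interval_bounded_random_variable "measure_pmf q" f "- B" B
    using B by unfold_locales (auto simp: abs_le_iff minus_le_iff)
  have ex: "measure_pmf.expectation q h = (\<Sum>y\<in>UNIV. pmf q y * h y)" for h :: "'y \<Rightarrow> real"
    by (subst integral_measure_pmf_real[where A=UNIV]) (auto simp: mult.commute)
  let ?a = "\<Sum>y\<in>UNIV. pmf q y * f y" and ?S = "\<Sum>y\<in>UNIV. pmf q y * exp (s * f y)"
  have "ennreal (measure_pmf.expectation q (\<lambda>y. exp (s * (f y - ?a)))) \<le> ennreal (exp (s\<^sup>2 * B\<^sup>2 / 2))"
    using Hoeffdings_lemma_nn_integral[OF s]
    by (subst nn_integral_eq_integral[symmetric])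
       (auto simp: ex power_mult_distrib mult.commute intro: integrable_measure_pmf_finite)
  then have "measure_pmf.expectation q (\<lambda>y. exp (s * (f y - ?a))) \<le> exp (s\<^sup>2 * B\<^sup>2 / 2)"
    by simp
  moreover have "measure_pmf.expectation q (\<lambda>y. exp (s * (f y - ?a))) = ?S / exp (s * ?a)"
    unfolding ex by (simp add: exp_diff algebra_simps sum_divide_distrib)
  ultimately have "?S \<le> exp (s\<^sup>2 * B\<^sup>2 / 2) * exp (s * ?a)"
    by (simp add: divide_le_eq)
  also have "\<dots> = exp (s * ?a + s\<^sup>2 * B\<^sup>2 / 2)"
    by (simp add: exp_add)
  finally have "?S \<le> exp (s * ?a + s\<^sup>2 * B\<^sup>2 / 2)" .
  moreover have "0 < ?S"
  proof -
    obtain y0 where "y0 \<in> set_pmf q"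
      using set_pmf_not_empty[of q] by auto
    then have "0 < pmf q y0 * exp (s * f y0)"
      by (simp add: pmf_positive)
    also have "\<dots> \<le> ?S"
      by (rule member_le_sum) auto
    finally show ?thesis .
  qed
  ultimately show ?thesis
    using ln_le_cancel_iff[of ?S "exp (s * ?a + s\<^sup>2 * B\<^sup>2 / 2)"] by simp
qed

text \<open>Both parts insert the Hoeffding bound into the identity for the tilt \<open>g\<close>.
  The first only uses \<open>KL_act p g \<ge> 0\<close>, so it holds for any step size, including
  steps the algorithm never takes. In the second, the objective at \<open>d\<close> equals
  \<open>?L - KL_act d g\<close>, so the maximiser can only be \<open>g\<close>.\<close>

lemma exp_tilt_step:
  fixes q :: "'y::finite pmf"
  assumes s: "0 < s" and B: "\<And>y. \<bar>f y\<bar> \<le> B" and p: "set_pmf p \<subseteq> set_pmf q"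
  shows "s * (\<Sum>y\<in>UNIV. (pmf p y - pmf q y) * f y) \<le> KL_act p q + s\<^sup>2 * B\<^sup>2 / 2"
    and "is_arg_max (\<lambda>d. s * (\<Sum>y\<in>UNIV. pmf d y * f y) - KL_act d q)
        (\<lambda>d. set_pmf d \<subseteq> set_pmf q) d \<Longrightarrow>
      set_pmf d = set_pmf q \<and>
      KL_act p d \<le> KL_act p q - s * (\<Sum>y\<in>UNIV. (pmf p y - pmf q y) * f y) + s\<^sup>2 * B\<^sup>2 / 2"
proof -
  let ?L = "ln (\<Sum>y\<in>UNIV. pmf q y * exp (s * f y))"
  obtain g where sg: "set_pmf g = set_pmf q"
    and g: "\<And>p. set_pmf p \<subseteq> set_pmf q \<Longrightarrow>
      KL_act p g = KL_act p q - (\<Sum>y\<in>UNIV. pmf p y * (s * f y)) + ?L"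
    using exists_exp_tilt[of q "\<lambda>y. s * f y"] by metis
  have sum_s: "(\<Sum>y\<in>UNIV. pmf p y * (s * f y)) = s * (\<Sum>y\<in>UNIV. pmf p y * f y)" for p :: "'y pmf"
    by (simp add: sum_distrib_left algebra_simps)
  have diff: "s * (\<Sum>y\<in>UNIV. (pmf p y - pmf q y) * f y) =
      s * (\<Sum>y\<in>UNIV. pmf p y * f y) - s * (\<Sum>y\<in>UNIV. pmf q y * f y)"
    by (simp add: algebra_simps sum_subtractf)
  have L: "?L \<le> s * (\<Sum>y\<in>UNIV. pmf q y * f y) + s\<^sup>2 * B\<^sup>2 / 2"
    by (rule ln_sum_exp_le[OF s B])
  have step: "KL_act p g \<le> KL_act p q - s * (\<Sum>y\<in>UNIV. (pmf p y - pmf q y) * f y) + s\<^sup>2 * B\<^sup>2 / 2"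
    using L g[OF p] unfolding sum_s diff by linarith
  moreover have "0 \<le> KL_act p g"
    using p sg by (simp add: KL_act_nonneg(1))
  ultimately show "s * (\<Sum>y\<in>UNIV. (pmf p y - pmf q y) * f y) \<le> KL_act p q + s\<^sup>2 * B\<^sup>2 / 2"
    by linarith
  assume max: "is_arg_max (\<lambda>d. s * (\<Sum>y\<in>UNIV. pmf d y * f y) - KL_act d q)
      (\<lambda>d. set_pmf d \<subseteq> set_pmf q) d"
  then have d: "set_pmf d \<subseteq> set_pmf q"
    by (simp add: is_arg_max_def)
  have "s * (\<Sum>y\<in>UNIV. pmf g y * f y) - KL_act g q \<le> s * (\<Sum>y\<in>UNIV. pmf d y * f y) - KL_act d q"
    using max sg by (auto simp: is_arg_max_linorder)
  then have "KL_act d g \<le> KL_act g g"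
    using g[OF d] g[of g] sg unfolding sum_s by simp
  then have "d = g"
    using KL_act_nonneg(2)[of d g] KL_act_nonneg(1)[of d g] d sg by simp
  then show "set_pmf d = set_pmf q \<and>
      KL_act p d \<le> KL_act p q - s * (\<Sum>y\<in>UNIV. (pmf p y - pmf q y) * f y) + s\<^sup>2 * B\<^sup>2 / 2"
    using sg step by simp
qed

subsection \<open>Backward recursion along trajectories\<close>

text \<open>The finite-horizon value function with running reward \<open>F\<close>, terminal reward
  \<open>g\<close> and \<open>n\<close> steps left. Trajectory KL, preferences and regularised
  values are all instances of it.\<close>

primrec path_value :: "('x, 'y::finite) pref_mdp \<Rightarrow> ('x, 'y) policy \<Rightarrow>
    ('x \<Rightarrow> real) \<Rightarrow> ('x \<Rightarrow> real) \<Rightarrow> nat \<Rightarrow> 'x \<Rightarrow> real" where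
  "path_value M \<pi> F g 0 x = g x"
| "path_value M \<pi> F g (Suc n) x = F x + (\<Sum>y\<in>UNIV. pmf (\<pi> x) y *
     measure_pmf.expectation (kernel M x y) (path_value M \<pi> F g n))"

text \<open>The part of the trajectory probability that does not depend on the policy.\<close>

primrec kernel_weight :: "('x, 'y::finite) pref_mdp \<Rightarrow> nat \<Rightarrow> 'x \<Rightarrow> ('x \<times> 'y) list \<Rightarrow> 'x \<Rightarrow> real" where
  "kernel_weight M 0 x xys z = (if xys = [] \<and> z = x then 1 else 0)"
| "kernel_weight M (Suc n) x xys z = (case xys of [] \<Rightarrow> 0
     | (x0, y0) # r \<Rightarrow> if x0 = x
         then measure_pmf.expectation (kernel M x y0) (\<lambda>x'. kernel_weight M n x' r z) else 0)"

lemma traj_from_Suc: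
  "traj_from M \<pi> (Suc n) x = bind_pmf (\<pi> x) (traj_from_action M \<pi> n x)"
  by (simp add: traj_from_action_def[abs_def])

text \<open>This factorisation makes the dynamics cancel when the trajectory probabilities of two
  policies are divided.\<close>

lemma pmf_traj_from:
  "pmf (traj_from M \<pi> n x) (xys, z) =
    (\<Prod>(x, y)\<leftarrow>xys. pmf (\<pi> x) y) * kernel_weight M n x xys z"
proof (induction n arbitrary: x xys)
  case 0
  then show ?case by (auto simp: indicator_def)
next
  case (Suc n)
  let ?c = "\<lambda>x y. (\<lambda>(xys, z). ((x, y) # xys, z)) :: ('a, 'b) trajectory \<Rightarrow> _"
  show ?case
  proof (cases xys)
    case Nil
    have "pmf (map_pmf (?c x y) p) ([], z) = 0" for y p
      by (rule pmf_map_outside) auto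
    then show ?thesis
      using Nil by (simp add: pmf_bind)
  next
    case (Cons a r)
    obtain x0 y0 where a: "a = (x0, y0)"
      by fastforce
    \<comment> \<open>Prepending a fixed pair is injective, so among all first actions only
      \<open>y0\<close> contributes mass.\<close>
    have inj: "inj (?c x y)" for x y
      by (auto simp: inj_def)
    have "pmf (map_pmf (?c x y) (traj_from M \<pi> n x')) ((x0, y0) # r, z) =
        (if x0 = x \<and> y0 = y then pmf (traj_from M \<pi> n x') (r, z) else 0)" for y x'
      using pmf_map_inj'[OF inj, of x y "traj_from M \<pi> n x'" "(r, z)"]
      by (auto intro!: pmf_map_outside)
    then have "pmf (traj_from M \<pi> (Suc n) x) ((x0, y0) # r, z) =
        (\<Sum>y\<in>UNIV. if y = y0 then (if x0 = x then
          pmf (\<pi> x) y * measure_pmf.expectation (kernel M x y) (\<lambda>x'. pmf (traj_from M \<pi> n x') (r, z)) else 0) else 0)"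
      by (simp add: pmf_bind integral_measure_pmf_real[of UNIV] mult.commute if_distrib cong: if_cong)
        (auto intro!: sum.cong)
    then show ?thesis
      using Cons a by (simp add: Suc.IH)
  qed
qed

section \<open>Calculus of path values in a well-formed model\<close>

context
  fixes M :: "('x, 'y::finite) pref_mdp"
  assumes wf: "pref_mdp_wf M"
begin

lemma kernel_subset_layer:
  assumes "x \<in> layer M h" "h \<in> {1..horizon M}"
  shows "set_pmf (kernel M x y) \<subseteq> layer M (Suc h)" "finite (layer M (Suc h))"
  using wf assms by (auto simp: pref_mdp_wf_def)

lemma kernel_expectation:
  fixes f :: "'x \<Rightarrow> real"
  assumes "x \<in> layer M h" "h \<in> {1..horizon M}"
  shows "measure_pmf.expectation (kernel M x y) f = (\<Sum>x'\<in>layer M (Suc h). f x' * pmf (kernel M x y) x')"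
  using kernel_subset_layer[OF assms] by (intro integral_measure_pmf_real) auto

text \<open>Backward induction from the terminal layer. The equation
  \<open>h + n = Suc (horizon M)\<close> ties the recursion counter to the layer, which makes kernel
  expectations finite sums over the next layer.\<close>

lemma layer_induct [consumes 3, case_names terminal step]:
  assumes "x \<in> layer M h" "1 \<le> h" "h + n = Suc (horizon M)"
    and "\<And>x. x \<in> layer M (Suc (horizon M)) \<Longrightarrow> P 0 x"
    and "\<And>n h x. x \<in> layer M h \<Longrightarrow> h \<in> {1..horizon M} \<Longrightarrow> x \<in> decision_states M \<Longrightarrow>
      n = horizon M - h \<Longrightarrow> (\<And>x'. x' \<in> layer M (Suc h) \<Longrightarrow> P n x') \<Longrightarrow> P (Suc n) x"
  shows "P n x"
  using assms(1-3)
proof (induction n arbitrary: h x)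
  case 0
  then show ?case using assms(4) by simp
next
  case (Suc n)
  then show ?case
    by (intro assms(5)[of x h]) (auto simp: decision_states_def)
qed

lemma traj_from_support:
  assumes "x \<in> layer M h" "1 \<le> h" "h + n = Suc (horizon M)"
  shows "finite (set_pmf (traj_from M \<pi> n x)) \<and>
    (\<forall>(xys, z)\<in>set_pmf (traj_from M \<pi> n x). z \<in> layer M (Suc (horizon M)) \<and>
      (\<forall>(x', y')\<in>set xys. x' \<in> decision_states M \<and> y' \<in> set_pmf (\<pi> x')))"
  using assms
proof (induction rule: layer_induct)
  case (step n h x)
  note k = kernel_subset_layer[OF step(1,2)]
  have "finite (set_pmf (kernel M x y))" for y
    using k finite_subset by blast
  then show ?case
    using step k by (fastforce simp: split_beta)
qed simp

lemma traj_from_action_expectation: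
  assumes "x \<in> layer M h" "h \<in> {1..horizon M}" "n = horizon M - h"
  shows "finite (set_pmf (traj_from_action M \<pi> n x y))"
    and "measure_pmf.expectation (traj_from_action M \<pi> n x y) \<phi> =
      measure_pmf.expectation (kernel M x y) (\<lambda>x'.
        measure_pmf.expectation (traj_from M \<pi> n x') (\<lambda>\<tau>. \<phi> ((x, y) # fst \<tau>, snd \<tau>)) :: real)"
proof -
  note k = kernel_subset_layer[OF assms(1,2)]
  have fin: "finite (set_pmf (traj_from M \<pi> n x'))" if "x' \<in> layer M (Suc h)" for x'
    using traj_from_support[of x' "Suc h" n \<pi>] that assms by auto
  show "finite (set_pmf (traj_from_action M \<pi> n x y))"
    unfolding traj_from_action_def using k fin finite_subset[OF k]
    by (auto simp: set_bind_pmf)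
  show "measure_pmf.expectation (traj_from_action M \<pi> n x y) \<phi> =
      measure_pmf.expectation (kernel M x y) (\<lambda>x'.
        measure_pmf.expectation (traj_from M \<pi> n x') (\<lambda>\<tau>. \<phi> ((x, y) # fst \<tau>, snd \<tau>)))"
    unfolding traj_from_action_def kernel_expectation[OF assms(1,2)]
    by (subst pmf_expectation_bind[of "layer M (Suc h)"])
       (use k fin in \<open>auto simp: mult.commute split_beta\<close>)
qed

text \<open>The bridge from trajectory expectations to the recursion: given the current state, the
  reward of an action may be replaced by its average under the policy.\<close>

lemma traj_from_expectation:
  assumes "x \<in> layer M h" "1 \<le> h" "h + n = Suc (horizon M)"
  shows "measure_pmf.expectation (traj_from M \<pi> n x) (\<lambda>(xys, z). g z + (\<Sum>(x', y')\<leftarrow>xys. f x' y')) =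
    path_value M \<pi> (\<lambda>x. \<Sum>y\<in>UNIV. pmf (\<pi> x) y * f x y) g n x"
  using assms
proof (induction rule: layer_induct)
  case (step n h x)
  let ?F = "\<lambda>x. \<Sum>y\<in>UNIV. pmf (\<pi> x) y * f x y"
  let ?\<phi> = "\<lambda>(xys, z). g z + (\<Sum>(x', y')\<leftarrow>xys. f x' y')"
  note act = traj_from_action_expectation[OF step(1,2,4)]
  have fin: "finite (set_pmf (traj_from M \<pi> n x'))" if "x' \<in> layer M (Suc h)" for x'
    using traj_from_support[of x' "Suc h" n \<pi>] that step by auto
  have shift: "measure_pmf.expectation (traj_from M \<pi> n x') (\<lambda>\<tau>. ?\<phi> ((x, y) # fst \<tau>, snd \<tau>)) =
      f x y + path_value M \<pi> ?F g n x'" if x': "x' \<in> layer M (Suc h)" for x' y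
  proof -
    have "(\<lambda>\<tau>. ?\<phi> ((x, y) # fst \<tau>, snd \<tau>)) = (\<lambda>\<tau>. f x y + ?\<phi> \<tau>)"
      by (auto simp: fun_eq_iff)
    then show ?thesis
      using step(5)[OF x'] fin[OF x']
      by (simp add: Bochner_Integration.integral_add integrable_measure_pmf_finite)
  qed
  have k1: "(\<Sum>x'\<in>layer M (Suc h). pmf (kernel M x y) x') = 1" for y
    using kernel_subset_layer[OF step(1,2)] by (simp add: sum_pmf_eq_1)
  have act': "measure_pmf.expectation (traj_from_action M \<pi> n x y) ?\<phi> =
      f x y + measure_pmf.expectation (kernel M x y) (path_value M \<pi> ?F g n)" for y
    unfolding act(2) kernel_expectation[OF step(1,2)]
    by (simp only: shift cong: sum.cong) (simp add: distrib_right sum.distrib k1 flip: sum_distrib_left)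
  have "measure_pmf.expectation (traj_from M \<pi> (Suc n) x) ?\<phi> =
      (\<Sum>y\<in>UNIV. pmf (\<pi> x) y * measure_pmf.expectation (traj_from_action M \<pi> n x y) ?\<phi>)"
    unfolding traj_from_Suc using act(1) by (subst pmf_expectation_bind[of UNIV]) auto
  then show ?case
    unfolding act' by (simp add: distrib_left sum.distrib)
qed simp

lemma path_value_mono:
  assumes "x \<in> layer M h" "1 \<le> h" "h + n = Suc (horizon M)"
    and "\<And>x. x \<in> decision_states M \<Longrightarrow> F x \<le> F' x"
  shows "path_value M \<pi> F g n x \<le> path_value M \<pi> F' g n x"
  using assms(1-3)
proof (induction rule: layer_induct)
  case (step n h x)
  then show ?case
    using assms(4)[of x]
    by (simp add: kernel_expectation[OF step(1,2)])
      (intro add_mono sum_mono mult_mono order_refl mult_left_mono mult_right_mono, auto)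
qed simp

lemma path_value_linear:
  assumes "x \<in> layer M h" "1 \<le> h" "h + n = Suc (horizon M)"
  shows "path_value M \<pi> (\<lambda>x. a * F x + b * F' x) (\<lambda>x. a * g x + b * g' x) n x =
    a * path_value M \<pi> F g n x + b * path_value M \<pi> F' g' n x"
  using assms
proof (induction rule: layer_induct)
  case (step n h x)
  then show ?case
    by (simp add: kernel_expectation[OF step(1,2)] distrib_left distrib_right sum.distrib sum_distrib_left mult_ac)
qed simp

lemma path_value_const:
  assumes "x \<in> layer M h" "1 \<le> h" "h + n = Suc (horizon M)"
  shows "path_value M \<pi> (\<lambda>_. a) (\<lambda>_. 0) n x = real n * a"
  using assms
proof (induction rule: layer_induct)
  case (step n h x)
  have "(\<Sum>x'\<in>layer M (Suc h). pmf (kernel M x y) x') = 1" for y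
    using kernel_subset_layer[OF step(1,2)] by (simp add: sum_pmf_eq_1)
  with step show ?case
    by (simp add: kernel_expectation[OF step(1,2)] sum_pmf_eq_1 distrib_right flip: sum_distrib_left sum_distrib_right)
qed simp

text \<open>At one state, \<open>\<pi>' V' - \<pi> V = \<pi>' (V' - V) + (\<pi>' - \<pi>) V\<close>,
  where \<open>V\<close> and \<open>V'\<close> are the expected continuation values. The induction
  hypothesis bounds the first summand and \<open>A\<close> the second; the common terminal reward
  cancels.\<close>

lemma performance_difference_le:
  assumes "x \<in> layer M h" "1 \<le> h" "h + n = Suc (horizon M)"
    and A: "\<And>h x. h \<in> {1..horizon M} \<Longrightarrow> x \<in> layer M h \<Longrightarrow>
      (\<Sum>y\<in>UNIV. (pmf (\<pi>' x) y - pmf (\<pi> x) y) *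
        measure_pmf.expectation (kernel M x y) (path_value M \<pi> F g (horizon M - h))) \<le> A x"
  shows "path_value M \<pi>' F' g n x - path_value M \<pi> F g n x
    \<le> path_value M \<pi>' (\<lambda>x. A x + F' x - F x) (\<lambda>_. 0) n x"
  using assms(1-3)
proof (induction rule: layer_induct)
  case (step n h x)
  let ?E = "\<lambda>y f. measure_pmf.expectation (kernel M x y) f"
  let ?V' = "path_value M \<pi>' F' g n" and ?V = "path_value M \<pi> F g n"
  let ?D = "path_value M \<pi>' (\<lambda>x. A x + F' x - F x) (\<lambda>_. 0) n"
  have "?E y ?V' - ?E y ?V \<le> ?E y ?D" for y
    unfolding kernel_expectation[OF step(1,2)] sum_subtractf[symmetric] left_diff_distrib[symmetric]
    using step(5) by (intro sum_mono mult_right_mono) auto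
  then have "(\<Sum>y\<in>UNIV. pmf (\<pi>' x) y * (?E y ?V' - ?E y ?V)) \<le> (\<Sum>y\<in>UNIV. pmf (\<pi>' x) y * ?E y ?D)"
    by (intro sum_mono mult_left_mono) auto
  moreover have "(\<Sum>y\<in>UNIV. (pmf (\<pi>' x) y - pmf (\<pi> x) y) * ?E y ?V) \<le> A x"
    using A[OF step(2,1)] step(4) by simp
  ultimately show ?case
    by (simp add: algebra_simps sum_subtractf)
qed simp

section \<open>KL divergences, preferences and Q-functions as path values\<close>

lemma start_layer: "start M \<in> layer M 1" "1 + horizon M = Suc (horizon M)" "(1::nat) \<le> 1"
  using wf by (auto simp: pref_mdp_wf_def)

lemma traj_support:
  assumes "(xys, z) \<in> set_pmf (traj M \<pi>)"
  shows "z \<in> layer M (Suc (horizon M))"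
    and "(x, y) \<in> set xys \<Longrightarrow> x \<in> decision_states M \<and> y \<in> set_pmf (\<pi> x)"
  using traj_from_support[OF start_layer(1,3,2), of \<pi>] assms by (fastforce simp: traj_def)+

lemma finite_traj: "finite (set_pmf (traj M \<pi>))"
  using traj_from_support[OF start_layer(1,3,2), of \<pi>] by (simp add: traj_def)

text \<open>The chain rule for KL: kernel weights cancel in the likelihood ratio, whose logarithm is
  then a sum of action log-ratios along the trajectory. Averaging each over the action gives the
  local KL.\<close>

lemma KL_traj_eq_path_value:
  assumes sub: "\<And>x. x \<in> decision_states M \<Longrightarrow> set_pmf (\<pi> x) \<subseteq> set_pmf (\<rho> x)"
  shows "KL_traj M \<pi> \<rho> = path_value M \<pi> (\<lambda>x. KL_act (\<pi> x) (\<rho> x)) (\<lambda>_. 0) (horizon M) (start M)"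
proof -
  let ?r = "\<lambda>x y. ln (pmf (\<pi> x) y / pmf (\<rho> x) y)"
  let ?w = "\<lambda>\<pi> xys. \<Prod>(x, y)\<leftarrow>xys. pmf (\<pi> x) y"
  have pos: "0 < ?w \<pi> xys \<and> 0 < ?w \<rho> xys \<and> ln (?w \<pi> xys / ?w \<rho> xys) = (\<Sum>(x, y)\<leftarrow>xys. ?r x y)"
    if "\<And>x y. (x, y) \<in> set xys \<Longrightarrow> 0 < pmf (\<pi> x) y \<and> 0 < pmf (\<rho> x) y" for xys
    using that
  proof (induction xys)
    case (Cons a xys)
    obtain x y where a: "a = (x, y)" by fastforce
    have "0 < pmf (\<pi> x) y" "0 < pmf (\<rho> x) y"
      using Cons.prems a by auto
    moreover have "0 < ?w \<pi> xys \<and> 0 < ?w \<rho> xys \<and> ln (?w \<pi> xys / ?w \<rho> xys) = (\<Sum>(x, y)\<leftarrow>xys. ?r x y)"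
      using Cons by auto
    moreover from calculation have "ln (pmf (\<pi> x) y * ?w \<pi> xys / (pmf (\<rho> x) y * ?w \<rho> xys)) =
        ?r x y + ln (?w \<pi> xys / ?w \<rho> xys)"
      by (simp add: ln_div ln_mult del: divide_divide_eq_right)
    ultimately show ?case
      by (simp add: a)
  qed simp
  have supp: "pmf (traj M \<rho>) (xys, z) > 0 \<and>
      ln (pmf (traj M \<pi>) (xys, z) / pmf (traj M \<rho>) (xys, z)) = (\<Sum>(x, y)\<leftarrow>xys. ?r x y)"
    if \<tau>: "(xys, z) \<in> set_pmf (traj M \<pi>)" for xys z
  proof -
    let ?k = "kernel_weight M (horizon M) (start M) xys z"
    have p: "0 < ?w \<pi> xys" "0 < ?w \<rho> xys" "ln (?w \<pi> xys / ?w \<rho> xys) = (\<Sum>(x, y)\<leftarrow>xys. ?r x y)"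
      using pos[of xys] traj_support(2)[OF \<tau>] sub by (blast intro: pmf_positive)+
    have t: "pmf (traj M \<pi>) (xys, z) = ?w \<pi> xys * ?k" for \<pi>
      by (simp add: traj_def pmf_traj_from)
    have "0 < ?w \<pi> xys * ?k"
      using \<tau> t[of \<pi>] by (metis pmf_positive)
    then have "0 < ?k"
      using p(1) by (simp add: zero_less_mult_iff)
    then show ?thesis
      using p by (simp add: t)
  qed
  then have "set_pmf (traj M \<pi>) \<subseteq> set_pmf (traj M \<rho>)"
    by (fastforce simp: set_pmf_iff)
  then have "KL_traj M \<pi> \<rho> = (\<Sum>\<tau>\<in>set_pmf (traj M \<pi>). pmf (traj M \<pi>) \<tau> *
      ln (pmf (traj M \<pi>) \<tau> / pmf (traj M \<rho>) \<tau>))"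
    unfolding KL_traj_def by (intro KL_divergence_pmf_finite finite_traj)
  also have "\<dots> = (\<Sum>\<tau>\<in>set_pmf (traj M \<pi>). (case \<tau> of (xys, z) \<Rightarrow> 0 + (\<Sum>(x, y)\<leftarrow>xys. ?r x y)) *
      pmf (traj M \<pi>) \<tau>)"
    using supp by (intro sum.cong) (auto simp: split_beta mult.commute)
  also have "\<dots> = measure_pmf.expectation (traj M \<pi>) (\<lambda>(xys, z). 0 + (\<Sum>(x, y)\<leftarrow>xys. ?r x y))"
    by (rule integral_measure_pmf_real[symmetric, OF finite_traj])
  also have "\<dots> = path_value M \<pi> (\<lambda>x. KL_act (\<pi> x) (\<rho> x)) (\<lambda>_. 0) (horizon M) (start M)"
    unfolding traj_def KL_act_def by (rule traj_from_expectation[OF start_layer(1,3,2)])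
  finally show ?thesis .
qed

text \<open>Exchanging two independent trajectories of the same policy turns \<open>pref\<close>
  into \<open>1 - pref\<close>, so the value \<open>v\<close> satisfies
  \<open>v = 1 - v\<close>.\<close>

lemma pref_policy_self: "pref_policy M \<pi> \<pi> = 1 / 2"
proof -
  let ?T = "set_pmf (traj M \<pi>)" and ?p = "pmf (traj M \<pi>)"
  have ex: "measure_pmf.expectation (traj M \<pi>) f = (\<Sum>\<tau>\<in>?T. f \<tau> * ?p \<tau>)" for f :: "_ \<Rightarrow> real"
    by (rule integral_measure_pmf_real[OF finite_traj]) simp
  have eq: "pref_policy M \<pi> \<pi> = (\<Sum>\<tau>\<in>?T. \<Sum>\<tau>'\<in>?T. pref M (snd \<tau>) (snd \<tau>') * (?p \<tau> * ?p \<tau>'))"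
    unfolding pref_policy_def pref_state_def ex split_beta
    by (simp add: sum_distrib_left sum_distrib_right mult_ac)
  also have "\<dots> = (\<Sum>\<tau>'\<in>?T. \<Sum>\<tau>\<in>?T. pref M (snd \<tau>) (snd \<tau>') * (?p \<tau> * ?p \<tau>'))"
    by (rule sum.swap)
  also have "\<dots> = (\<Sum>\<tau>'\<in>?T. \<Sum>\<tau>\<in>?T. (1 - pref M (snd \<tau>') (snd \<tau>)) * (?p \<tau>' * ?p \<tau>))"
  proof (intro sum.cong refl)
    fix \<tau> \<tau>' assume "\<tau> \<in> ?T" "\<tau>' \<in> ?T"
    then have "snd \<tau> \<in> layer M (horizon M + 1)" "snd \<tau>' \<in> layer M (horizon M + 1)"
      using traj_support(1)[of "fst \<tau>" "snd \<tau>"] traj_support(1)[of "fst \<tau>'" "snd \<tau>'"] by simp_all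
    then have "pref M (snd \<tau>) (snd \<tau>') = 1 - pref M (snd \<tau>') (snd \<tau>)"
      using wf unfolding pref_mdp_wf_def by blast
    then show "pref M (snd \<tau>) (snd \<tau>') * (?p \<tau> * ?p \<tau>') = (1 - pref M (snd \<tau>') (snd \<tau>)) * (?p \<tau>' * ?p \<tau>)"
      by simp
  qed
  also have "\<dots> = (\<Sum>\<tau>'\<in>?T. \<Sum>\<tau>\<in>?T. ?p \<tau>' * ?p \<tau>) - pref_policy M \<pi> \<pi>"
    unfolding eq by (simp add: left_diff_distrib sum_subtractf)
  also have "(\<Sum>\<tau>'\<in>?T. \<Sum>\<tau>\<in>?T. ?p \<tau>' * ?p \<tau>) = 1"
    by (simp add: sum_pmf_eq_1 finite_traj flip: sum_distrib_left)
  finally show ?thesis by simp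
qed

lemma pref_policy_eq_path_value:
  "pref_policy M \<pi> \<pi>' = path_value M \<pi> (\<lambda>_. 0) (\<lambda>z. pref_state M z \<pi>') (horizon M) (start M)"
  using traj_from_expectation[OF start_layer(1,3,2), of \<pi> "\<lambda>z. pref_state M z \<pi>'" "\<lambda>_ _. 0"]
  by (simp add: pref_policy_def traj_def case_prod_unfold)

lemma Qfun_eq_path_value:
  assumes "x \<in> layer M h" "h \<in> {1..horizon M}"
  shows "Qfun M \<mu> \<alpha> \<pi> \<pi>' h x y = - \<alpha> * KL_act (\<pi> x) (\<mu> x) +
    measure_pmf.expectation (kernel M x y)
      (path_value M \<pi> (\<lambda>x. - \<alpha> * KL_act (\<pi> x) (\<mu> x)) (\<lambda>z. pref_state M z \<pi>') (horizon M - h))"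
proof -
  let ?K = "\<lambda>x. KL_act (\<pi> x) (\<mu> x)" and ?n = "horizon M - h"
  let ?g = "\<lambda>z. pref_state M z \<pi>'"
  have "measure_pmf.expectation (traj_from M \<pi> ?n x') (\<lambda>\<tau>. ?g (snd \<tau>) -
      \<alpha> * (\<Sum>(x', y')\<leftarrow>(x, y) # fst \<tau>. ?K x')) =
      - \<alpha> * ?K x + path_value M \<pi> (\<lambda>x. - \<alpha> * ?K x) ?g ?n x'"
    if x': "x' \<in> layer M (Suc h)" for x'
  proof -
    have "(\<lambda>\<tau> :: ('x, 'y) trajectory. ?g (snd \<tau>) - \<alpha> * (\<Sum>(x', y')\<leftarrow>(x, y) # fst \<tau>. ?K x')) =
        (\<lambda>\<tau>. - \<alpha> * ?K x + (case \<tau> of (xys, z) \<Rightarrow> ?g z + (\<Sum>(x', y')\<leftarrow>xys. - \<alpha> * ?K x')))"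
      by (auto simp: fun_eq_iff case_prod_unfold algebra_simps uminus_sum_list_map o_def simp flip: sum_list_const_mult)
    moreover have "finite (set_pmf (traj_from M \<pi> ?n x'))"
      using traj_from_support[OF x'] assms by auto
    moreover have "(\<Sum>y\<in>UNIV. pmf (\<pi> x) y * (- \<alpha> * ?K x)) = - \<alpha> * ?K x" for x
      by (simp only: sum_distrib_right[symmetric]) (simp add: sum_pmf_eq_1)
    ultimately show ?thesis
      using traj_from_expectation[OF x', of ?n \<pi> ?g "\<lambda>x y. - \<alpha> * ?K x"] assms
      by (simp only:) (simp add: Bochner_Integration.integral_add integrable_measure_pmf_finite)
  qed
  moreover have "(\<Sum>x'\<in>layer M (Suc h). pmf (kernel M x y) x') = 1"
    using kernel_subset_layer[OF assms] by (simp add: sum_pmf_eq_1)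
  ultimately show ?thesis
    unfolding Qfun_def traj_from_action_expectation[OF assms refl] kernel_expectation[OF assms]
    by (simp add: split_beta left_diff_distrib sum_subtractf cong: sum.cong flip: sum_distrib_left)
qed

text \<open>The KL term of \<open>x\<close> itself in the Q-function does not depend on
  \<open>y\<close> and cancels between \<open>p\<close> and \<open>q\<close>. Hence Q-functions can
  stand in for the continuation values in \<open>performance_difference_le\<close>.\<close>

lemma sum_Qfun_diff:
  fixes p q :: "'y pmf"
  assumes "x \<in> layer M h" "h \<in> {1..horizon M}"
  shows "(\<Sum>y\<in>UNIV. (pmf p y - pmf q y) * Qfun M \<mu> \<alpha> \<pi> \<pi>' h x y) =
    (\<Sum>y\<in>UNIV. (pmf p y - pmf q y) * measure_pmf.expectation (kernel M x y)
      (path_value M \<pi> (\<lambda>x. - \<alpha> * KL_act (\<pi> x) (\<mu> x)) (\<lambda>z. pref_state M z \<pi>') (horizon M - h)))"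
  unfolding Qfun_eq_path_value[OF assms] left_diff_distrib sum_subtractf sum_pmf_add_const by simp

text \<open>Against the opponent \<open>\<pi>\<close>, the equilibrium has at least the regularised
  value of \<open>\<pi>\<close> itself, since both self-play preferences equal 1/2. The performance
  difference, with continuation under \<open>\<pi>\<close>, rewrites this gap through exactly the
  Q-functions of the algorithm; the KL terms are the difference of the running rewards.\<close>

lemma nash_regularized_gap:
  assumes nash: "nash_equilibrium M \<mu> \<alpha> \<pi>s" and adm: "admissible M \<mu> \<pi>"
    and A: "\<And>h x. h \<in> {1..horizon M} \<Longrightarrow> x \<in> layer M h \<Longrightarrow>
      (\<Sum>y\<in>UNIV. (pmf (\<pi>s x) y - pmf (\<pi> x) y) * Qfun M \<mu> \<alpha> \<pi> \<pi> h x y) \<le> A x"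
  shows "0 \<le> path_value M \<pi>s (\<lambda>x. A x - \<alpha> * KL_act (\<pi>s x) (\<mu> x) + \<alpha> * KL_act (\<pi> x) (\<mu> x))
    (\<lambda>_. 0) (horizon M) (start M)"
proof -
  note start = start_layer(1,3,2)
  let ?g = "\<lambda>z. pref_state M z \<pi>" and ?K = "\<lambda>\<pi> x. KL_act (\<pi> x) (\<mu> x)"
  have sub: "set_pmf (\<pi> x) \<subseteq> set_pmf (\<mu> x)" if "admissible M \<mu> \<pi>" "x \<in> decision_states M" for \<pi> x
    using that by (auto simp: admissible_def set_pmf_iff)
  have adm_s: "admissible M \<mu> \<pi>s"
    using nash by (simp add: nash_equilibrium_def)
  have val: "path_value M \<rho> (\<lambda>x. - \<alpha> * ?K \<rho> x) ?g (horizon M) (start M) =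
      pref_policy M \<rho> \<pi> - \<alpha> * KL_traj M \<rho> \<mu>" if "admissible M \<mu> \<rho>" for \<rho>
    using path_value_linear[OF start, of \<rho> 1 "\<lambda>_. 0" "- \<alpha>" "?K \<rho>" ?g "\<lambda>_. 0"]
    by (simp add: pref_policy_eq_path_value KL_traj_eq_path_value[OF sub[OF that]])
  have "reg_pref M \<mu> \<alpha> \<pi>s \<pi>s \<le> reg_pref M \<mu> \<alpha> \<pi>s \<pi>"
    using nash adm by (simp add: nash_equilibrium_def)
  then have "0 \<le> (pref_policy M \<pi>s \<pi> - \<alpha> * KL_traj M \<pi>s \<mu>) - (pref_policy M \<pi> \<pi> - \<alpha> * KL_traj M \<pi> \<mu>)"
    by (simp add: reg_pref_def pref_policy_self)
  also have "\<dots> \<le> path_value M \<pi>s (\<lambda>x. A x + - \<alpha> * ?K \<pi>s x - - \<alpha> * ?K \<pi> x) (\<lambda>_. 0) (horizon M) (start M)"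
    unfolding val[OF adm, symmetric] val[OF adm_s, symmetric]
    using A by (intro performance_difference_le[OF start]) (simp add: sum_Qfun_diff)
  finally show ?thesis
    by simp
qed

end

subsection \<open>Convergence\<close>

theorem theoremB2:
  fixes M :: "('x, 'y::finite) pref_mdp"
    and \<mu> \<pi>s :: "('x, 'y) policy"
    and \<pi> :: "nat \<Rightarrow> ('x, 'y) policy"
    and \<eta> :: "nat \<Rightarrow> real"
    and \<alpha> Qbd :: real
    and t :: nat
  assumes "pref_mdp_wf M"
    and "\<alpha> > 0"
    and "nash_equilibrium M \<mu> \<alpha> \<pi>s"
    and "\<And>t. t \<ge> 1 \<Longrightarrow> \<eta> t = 2 / (\<alpha> * (real t + 2))"
    and "mtpo_tau M \<mu> \<alpha> \<eta> \<pi>"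
    and "\<And>t h x y. t \<ge> 1 \<Longrightarrow> h \<in> {1..horizon M} \<Longrightarrow> x \<in> layer M h \<Longrightarrow>
          \<bar>Qfun M \<mu> \<alpha> (mixture_policy \<mu> \<alpha> \<eta> \<pi> t) (mixture_policy \<mu> \<alpha> \<eta> \<pi> t) h x y\<bar> \<le> Qbd"
    and "t \<ge> 1"
  shows "KL_traj M \<pi>s (mixture_policy \<mu> \<alpha> \<eta> \<pi> t)
    \<le> 9 * real (horizon M) * Qbd\<^sup>2 / (\<alpha>\<^sup>2 * (real t + 1))"
proof -
  note wf = assms(1) and \<alpha> = assms(2) and nash = assms(3) and \<eta> = assms(4)
    and mtpo = assms(5) and Qbd = assms(6)
  note start = start_layer(1,3,2)[OF wf]

  \<comment> \<open>Supports and local inequalities of the iterates\<close>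
  define mix where "mix = mixture_policy \<mu> \<alpha> \<eta> \<pi>"
  \<comment> \<open>The mixture weight \<open>\<eta> t * \<alpha>\<close>. For
    \<open>t \<ge> 1\<close> it is at most 2/3, hence strictly between 0 and 1 as
    \<open>geo_mixture_KL\<close> requires.\<close>
  define c where "c = (\<lambda>t. 2 / (real t + 2))"
  have c: "\<eta> t * \<alpha> = c t" "0 < c t" "c t < 1" "0 < \<eta> t" if "t \<ge> 1" for t
  proof -
    have "0 < \<alpha> * (real t + 2)"
      using \<alpha> by simp
    then show "\<eta> t * \<alpha> = c t" "0 < c t" "c t < 1" "0 < \<eta> t"
      using \<eta>[OF that] \<alpha> that by (simp_all add: c_def)
  qed
  have mix: "mix t x = geo_mixture (c t) (\<pi> t x) (\<mu> x)" if "t \<ge> 1" for t x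
    using c(1)[OF that] by (simp add: mix_def mixture_policy_def)
  have layer_dec: "x \<in> decision_states M" if "h \<in> {1..horizon M}" "x \<in> layer M h" for h x
    using that by (auto simp: decision_states_def)
  have adm_iff: "admissible M \<mu> \<rho> \<longleftrightarrow> (\<forall>x\<in>decision_states M. set_pmf (\<rho> x) \<subseteq> set_pmf (\<mu> x))" for \<rho>
    by (auto simp: admissible_def pmf_eq_0_set_pmf)
  have s_sub: "set_pmf (\<pi>s x) \<subseteq> set_pmf (\<mu> x)" if "x \<in> decision_states M" for x
    using nash that by (auto simp: nash_equilibrium_def adm_iff)
  have pi1: "\<pi> 1 x = \<mu> x" if "x \<in> decision_states M" for x
    using mtpo that by (simp add: mtpo_tau_def)
  have argmax: "is_arg_max (\<lambda>d. \<eta> t * (\<Sum>y\<in>UNIV. pmf d y * Qfun M \<mu> \<alpha> (mix t) (mix t) h x y) - KL_act d (mix t x))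
      (\<lambda>d. set_pmf d \<subseteq> set_pmf (\<mu> x)) (\<pi> (Suc t) x)"
    if "t \<ge> 1" "h \<in> {1..horizon M}" "x \<in> layer M h" for t h x
  proof -
    have "(\<forall>y. pmf (\<mu> x) y = 0 \<longrightarrow> pmf d y = 0) \<longleftrightarrow> set_pmf d \<subseteq> set_pmf (\<mu> x)" for d :: "'y pmf"
      by (auto simp: set_pmf_iff)
    then have eq: "(\<lambda>d. set_pmf d \<subseteq> set_pmf (\<mu> x)) = (\<lambda>d. \<forall>y. pmf (\<mu> x) y = 0 \<longrightarrow> pmf d y = 0)"
      by auto
    show ?thesis
      unfolding eq using mtpo that unfolding mtpo_tau_def Let_def mix_def by auto
  qed
  \<comment> \<open>The support equation is a premise because this step is applied inside the
    induction that establishes it for all iterates.\<close>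
  have md_step: "set_pmf (\<pi> (Suc t) x) = set_pmf (mix t x) \<and>
      KL_act p (\<pi> (Suc t) x) \<le> KL_act p (mix t x)
        - \<eta> t * (\<Sum>y\<in>UNIV. (pmf p y - pmf (mix t x) y) * Qfun M \<mu> \<alpha> (mix t) (mix t) h x y)
        + (\<eta> t)\<^sup>2 * Qbd\<^sup>2 / 2"
    if t: "t \<ge> 1" and h: "h \<in> {1..horizon M}" "x \<in> layer M h"
      and eq: "set_pmf (mix t x) = set_pmf (\<mu> x)" and p: "set_pmf p \<subseteq> set_pmf (\<mu> x)" for t h x p
    using argmax[OF t h] Qbd[OF t h] p unfolding eq[symmetric] mix_def[symmetric]
    by (intro exp_tilt_step(2)[OF c(4)[OF t]])
  have supp: "set_pmf (\<pi> t x) = set_pmf (\<mu> x)" if t: "t \<ge> 1" and x: "x \<in> decision_states M" for t x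
    using t
  proof (induction t rule: dec_induct)
    case base
    then show ?case using pi1[OF x] by simp
  next
    case (step t)
    obtain h where h: "h \<in> {1..horizon M}" "x \<in> layer M h"
      using x by (auto simp: decision_states_def)
    have "set_pmf (mix t x) = set_pmf (\<mu> x)"
      using step.IH step.hyps c by (simp add: mix geo_mixture_KL(1))
    then show ?case
      using md_step[OF step.hyps(1) h, of "\<mu> x"] by simp
  qed
  have mix_supp: "set_pmf (mix t x) = set_pmf (\<mu> x)" if "t \<ge> 1" "x \<in> decision_states M" for t x
    using supp[OF that] that c by (simp add: mix geo_mixture_KL(1))
  have adm_mix: "admissible M \<mu> (mix t)" if "t \<ge> 1" for t
    using mix_supp[OF that] by (simp add: adm_iff)
  have mix_KL: "KL_act (\<pi>s x) (mix t x) + c t * KL_act (mix t x) (\<mu> x)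
      \<le> (1 - c t) * KL_act (\<pi>s x) (\<pi> t x) + c t * KL_act (\<pi>s x) (\<mu> x)"
    if "t \<ge> 1" "x \<in> decision_states M" for t x
    unfolding mix[OF that(1)]
    using that c supp s_sub by (intro geo_mixture_KL(2)) auto

  \<comment> \<open>Passing from states to trajectories of the equilibrium\<close>
  let ?V = "\<lambda>F. path_value M \<pi>s F (\<lambda>_. 0) (horizon M) (start M)"
  define A where "A = (\<lambda>t. KL_traj M \<pi>s (\<pi> t))"
  define G where "G = real (horizon M) * Qbd\<^sup>2 / \<alpha>\<^sup>2"
  have G: "0 \<le> G"
    by (simp add: G_def)
  have A: "A t = ?V (\<lambda>x. KL_act (\<pi>s x) (\<pi> t x))" if "t \<ge> 1" for t
    unfolding A_def using supp[OF that] s_sub by (intro KL_traj_eq_path_value[OF wf]) simp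
  have lin: "?V (\<lambda>x. a * F x + b * F' x) = a * ?V F + b * ?V F'" for a b F F'
    using path_value_linear[OF wf start, of \<pi>s a F b F' "\<lambda>_. 0" "\<lambda>_. 0"] by simp
  have const: "?V (\<lambda>_. a) = real (horizon M) * a" for a
    by (rule path_value_const[OF wf start])
  note mono = path_value_mono[OF wf start, of _ _ \<pi>s "\<lambda>_. 0"]
  \<comment> \<open>The two integrands agree only on decision states, so the equality is obtained
    from monotonicity in both directions.\<close>
  have K1: "?V (\<lambda>x. KL_act (\<pi>s x) (\<mu> x)) = A 1"
    unfolding A[OF order_refl] using pi1 by (intro antisym mono) auto

  \<comment> \<open>The distance of the first iterate\<close>
  have A1: "A 1 \<le> 2 * G"
  proof -
    \<comment> \<open>Mixing \<open>\<mu>\<close> with itself returns \<open>\<mu>\<close>: for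
      \<open>p = d = m = \<mu> x\<close> the right-hand side of \<open>geo_mixture_KL\<close>
      vanishes.\<close>
    have mix1: "mix 1 x = \<mu> x" if x: "x \<in> decision_states M" for x
    proof -
      have "KL_act (\<mu> x) (mix 1 x) + c 1 * KL_act (mix 1 x) (\<mu> x) \<le> 0"
        using geo_mixture_KL(2)[of "c 1" "\<pi> 1 x" "\<mu> x" "\<mu> x"] pi1[OF x] c[of 1]
        by (simp add: mix)
      moreover have "0 \<le> KL_act (\<mu> x) (mix 1 x)" "0 \<le> KL_act (mix 1 x) (\<mu> x)"
        using mix_supp[OF order_refl x] by (simp_all add: KL_act_nonneg(1))
      ultimately have "KL_act (mix 1 x) (\<mu> x) = 0"
        using mult_pos_pos[OF c(2)[OF order_refl]] by (smt (verit))
      then show ?thesis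
        using mix_supp[OF order_refl x] KL_act_nonneg(2) by blast
    qed
    \<comment> \<open>A step of size \<open>s\<close> from \<open>\<mu>\<close> would give
      \<open>A 1 \<le> u^2 / (2 * (u - 1)) * G\<close> with \<open>u = s * \<alpha> > 1\<close>.
      This is smallest at \<open>u = 2\<close>, whence \<open>s = 2 / \<alpha>\<close> and the
      factor 2.\<close>
    have aux: "S \<le> \<alpha> / 2 * K + Qbd\<^sup>2 / \<alpha>" if "2 / \<alpha> * S \<le> K + (2 / \<alpha>)\<^sup>2 * Qbd\<^sup>2 / 2" for S K
      using that \<alpha> by (simp add: field_simps power2_eq_square)
    let ?A = "\<lambda>x. \<alpha> / 2 * KL_act (\<pi>s x) (\<mu> x) + Qbd\<^sup>2 / \<alpha>"
    have "0 \<le> ?V (\<lambda>x. ?A x - \<alpha> * KL_act (\<pi>s x) (\<mu> x) + \<alpha> * KL_act (mix 1 x) (\<mu> x))"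
    proof (rule nash_regularized_gap[OF wf nash adm_mix])
      fix h x assume h: "h \<in> {1..horizon M}" "x \<in> layer M h"
      note x = layer_dec[OF h]
      have "2 / \<alpha> * (\<Sum>y\<in>UNIV. (pmf (\<pi>s x) y - pmf (mix 1 x) y) * Qfun M \<mu> \<alpha> (mix 1) (mix 1) h x y)
          \<le> KL_act (\<pi>s x) (mix 1 x) + (2 / \<alpha>)\<^sup>2 * Qbd\<^sup>2 / 2"
        using \<alpha> Qbd[OF order_refl h] s_sub[OF x] mix1[OF x] by (intro exp_tilt_step(1)) (auto simp: mix_def)
      from aux[OF this] show "(\<Sum>y\<in>UNIV. (pmf (\<pi>s x) y - pmf (mix 1 x) y) * Qfun M \<mu> \<alpha> (mix 1) (mix 1) h x y) \<le> ?A x"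
        by (simp only: mix1[OF x])
    qed simp
    also have "\<dots> \<le> ?V (\<lambda>x. (- \<alpha> / 2) * KL_act (\<pi>s x) (\<mu> x) + 1 * (Qbd\<^sup>2 / \<alpha>))"
      by (rule mono) (simp add: mix1[simplified])
    also have "\<dots> = (- \<alpha> / 2) * A 1 + real (horizon M) * (Qbd\<^sup>2 / \<alpha>)"
      unfolding lin const K1 by simp
    finally show ?thesis
      using \<alpha> by (simp add: G_def field_simps power2_eq_square)
  qed

  \<comment> \<open>The one-step recursion\<close>
  have rec: "A (Suc t) \<le> (1 - c t) * A t + 2 * G / (real t + 2)\<^sup>2" if t: "t \<ge> 1" for t
  proof -
    let ?\<kappa> = "(\<eta> t)\<^sup>2 * Qbd\<^sup>2 / 2"
    \<comment> \<open>This is \<open>md_step\<close> solved for the inner product with the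
      Q-function.\<close>
    let ?A = "\<lambda>x. (KL_act (\<pi>s x) (mix t x) - KL_act (\<pi>s x) (\<pi> (Suc t) x) + ?\<kappa>) / \<eta> t"
    note \<eta>_pos = c(4)[OF t]
    have "0 \<le> ?V (\<lambda>x. ?A x - \<alpha> * KL_act (\<pi>s x) (\<mu> x) + \<alpha> * KL_act (mix t x) (\<mu> x))"
    proof (rule nash_regularized_gap[OF wf nash adm_mix[OF t]])
      fix h x assume h: "h \<in> {1..horizon M}" "x \<in> layer M h"
      note x = layer_dec[OF h]
      have "KL_act (\<pi>s x) (\<pi> (Suc t) x) \<le> KL_act (\<pi>s x) (mix t x) - \<eta> t *
          (\<Sum>y\<in>UNIV. (pmf (\<pi>s x) y - pmf (mix t x) y) * Qfun M \<mu> \<alpha> (mix t) (mix t) h x y) + ?\<kappa>"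
        using md_step[OF t h mix_supp[OF t x] s_sub[OF x]] ..
      then show "(\<Sum>y\<in>UNIV. (pmf (\<pi>s x) y - pmf (mix t x) y) * Qfun M \<mu> \<alpha> (mix t) (mix t) h x y) \<le> ?A x"
        using \<eta>_pos by (simp add: field_simps)
    qed
    also have "\<dots> \<le> ?V (\<lambda>x. 1 / \<eta> t * ((1 - c t) * KL_act (\<pi>s x) (\<pi> t x) + (- 1) * KL_act (\<pi>s x) (\<pi> (Suc t) x))
        + 1 / \<eta> t * ?\<kappa>)"
    \<comment> \<open>Multiplied by \<open>\<eta> t\<close>, the two regulariser terms acquire the
      coefficient \<open>c t\<close>, exactly as in \<open>mix_KL\<close>. That inequality therefore
      removes both and replaces the mixture by \<open>\<pi> t\<close> with factor
      \<open>1 - c t\<close>.\<close>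
    proof (rule mono)
      fix x assume "x \<in> decision_states M"
      from mix_KL[OF t this]
      have "KL_act (\<pi>s x) (mix t x) - KL_act (\<pi>s x) (\<pi> (Suc t) x) + ?\<kappa>
          - c t * KL_act (\<pi>s x) (\<mu> x) + c t * KL_act (mix t x) (\<mu> x)
          \<le> (1 - c t) * KL_act (\<pi>s x) (\<pi> t x) - KL_act (\<pi>s x) (\<pi> (Suc t) x) + ?\<kappa>"
        by linarith
      from divide_right_mono[OF this, of "\<eta> t"]
      show "?A x - \<alpha> * KL_act (\<pi>s x) (\<mu> x) + \<alpha> * KL_act (mix t x) (\<mu> x)
          \<le> 1 / \<eta> t * ((1 - c t) * KL_act (\<pi>s x) (\<pi> t x) + (- 1) * KL_act (\<pi>s x) (\<pi> (Suc t) x))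
            + 1 / \<eta> t * ?\<kappa>"
        using \<eta>_pos by (simp add: add_divide_distrib diff_divide_distrib flip: c(1)[OF t])
    qed
    also have "\<dots> = ((1 - c t) * A t - A (Suc t) + real (horizon M) * ?\<kappa>) / \<eta> t"
      unfolding lin const A[OF t, symmetric] A[of "Suc t", simplified, symmetric]
      by (simp add: add_divide_distrib diff_divide_distrib)
    finally have "A (Suc t) \<le> (1 - c t) * A t + real (horizon M) * ?\<kappa>"
      using \<eta>_pos by (simp add: zero_le_divide_iff)
    also have "real (horizon M) * ?\<kappa> = 2 * G / (real t + 2)\<^sup>2"
      using \<alpha> by (simp add: \<eta>[OF t] G_def power_divide power_mult_distrib)
    finally show ?thesis .
  qed

  \<comment> \<open>The rate of the iterates\<close>
  have At: "A t \<le> 2 * G / real t" if "t \<ge> 1" for t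
    using that
  proof (induction t rule: dec_induct)
    case base
    then show ?case using A1 by simp
  next
    case (step t)
    have "A (Suc t) \<le> (1 - c t) * A t + 2 * G / (real t + 2)\<^sup>2"
      by (rule rec[OF step.hyps(1)])
    also have "\<dots> \<le> (1 - c t) * (2 * G / real t) + 2 * G / (real t + 2)\<^sup>2"
      using step.IH c(3)[OF step.hyps(1)] by (intro add_mono mult_left_mono) auto
    \<comment> \<open>Since \<open>1 - c t = t / (t + 2)\<close>, the factor \<open>t\<close> of the
      induction hypothesis cancels.\<close>
    also have "\<dots> = 2 * G * (1 / (real t + 2) + 1 / (real t + 2)\<^sup>2)"
      using step.hyps(1) by (simp add: c_def field_simps)
    also have "\<dots> \<le> 2 * G * (1 / (real t + 1))"
    proof -
      \<comment> \<open>Equivalent to \<open>(u + 1) * (u - 1) \<le> u^2\<close>.\<close>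
      have "1 / u + 1 / u\<^sup>2 \<le> 1 / (u - 1)" if "1 < u" for u :: real
        using that by (simp add: field_simps power2_eq_square)
      from this[of "real t + 2"] show ?thesis
        using G by (intro mult_left_mono) (simp_all add: add.commute)
    qed
    finally show ?case by (simp add: add.commute)
  qed

  \<comment> \<open>From the iterates to the mixture policy\<close>
  have "KL_traj M \<pi>s (mix t) = ?V (\<lambda>x. KL_act (\<pi>s x) (mix t x))"
    using mix_supp[OF assms(7)] s_sub by (intro KL_traj_eq_path_value[OF wf]) simp
  also have "\<dots> \<le> ?V (\<lambda>x. (1 - c t) * KL_act (\<pi>s x) (\<pi> t x) + c t * KL_act (\<pi>s x) (\<mu> x))"
  proof (rule mono)
    fix x assume x: "x \<in> decision_states M"
    have "0 \<le> c t * KL_act (mix t x) (\<mu> x)"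
      using c(2)[OF assms(7)] mix_supp[OF assms(7) x] by (simp add: KL_act_nonneg(1))
    then show "KL_act (\<pi>s x) (mix t x) \<le> (1 - c t) * KL_act (\<pi>s x) (\<pi> t x) + c t * KL_act (\<pi>s x) (\<mu> x)"
      using mix_KL[OF assms(7) x] by linarith
  qed
  also have "\<dots> = (1 - c t) * A t + c t * A 1"
    unfolding lin K1 A[OF assms(7)] ..
  also have "\<dots> \<le> (1 - c t) * (2 * G / real t) + c t * (2 * G)"
    using c[OF assms(7)] At[OF assms(7)] A1 by (intro add_mono mult_left_mono) auto
  also have "\<dots> = 6 * G / (real t + 2)"
  proof -
    have "1 - c t = real t / (real t + 2)"
      by (simp add: c_def field_simps)
    then have "(1 - c t) * (2 * G / real t) = 2 * G / (real t + 2)"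
      using assms(7) by simp
    moreover have "c t * (2 * G) = 4 * G / (real t + 2)"
      by (simp add: c_def)
    ultimately show ?thesis
      by (simp flip: add_divide_distrib)
  qed
  \<comment> \<open>Both changes weaken the bound: the numerator grows and the denominator
    shrinks.\<close>
  also have "\<dots> \<le> 9 * G / (real t + 1)"
    using G by (intro frac_le) auto
  finally show ?thesis
    by (simp add: mix_def G_def)
qed

end
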